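(* Let $((X_1)_p,C_p,B_p,D_p)_{p\ge0}$ be a sequence generated by the alternating minimization scheme described in the context, and let $m_p=F((X_1)_p,C_p,B_p,D_p)$. Then: (i) $\displaystyle\sum_{p=1}^{\infty}\|B_{p+1}D_{p+1}-B_pD_p\|_F^2<\infty$ and $\displaystyle\sum_{p=1}^{\infty}\|((X_1)_p-(X_1)_{p+1})\odot W_1\|_F^2<\infty$. (ii) If $\sum_{p=1}^{\infty}\sqrt{m_p-m_{p+1}}<+\infty$, then $\lim_{p\to\infty}B_pD_p$ and $\lim_{p\to\infty}(X_1)_p$ exist. Furthermore, writing $L^*:=\lim_{p\to\infty}B_pD_p$, one has $\lim_{p\to\infty}B_{p+1}D_p=L^*$.
   Context: Fix integers $k\le r\le\min\{m,n\}$, matrices $A_1\in\mathbb{R}^{m\times k}$, $A_2\in\mathbb{R}^{m\times(n-k)}$, and a weight matrix $W_1\in\mathbb{R}^{m\times k}$ with $(W_1)_{ij}>0$ for all $i,j$. $\|\cdot\|_F$ is the Frobenius norm and $\odot$ is the Hadamard (entrywise) product. For $X_1\in\mathbb{R}^{m\times k}$, $C\in\mathbb{R}^{k\times(n-k)}$, $B\in\mathbb{R}^{m\times(r-k)}$, $D\in\mathbb{R}^{(r-k)\times(n-k)}$ let $$F(X_1,C,B,D)=\|(A_1-X_1)\odot W_1\|_F^2+\|A_2-X_1C-BD\|_F^2 .$$ Alternating minimization scheme: starting from some initial $((X_1)_0,C_0,B_0,D_0)$, for $p=0,1,2,\dots$ define successively $$(X_1)_{p+1}=\arg\min_{X_1}F(X_1,C_p,B_p,D_p),\quad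 C_{p+1}=\arg\min_{C}F((X_1)_{p+1},C,B_p,D_p),$$ $$B_{p+1}=\arg\min_{B}F((X_1)_{p+1},C_{p+1},B,D_p),\quad D_{p+1}=\arg\min_{D}F((X_1)_{p+1},C_{p+1},B_{p+1},D).$$ *)

theory Defs
  imports Complex_Main "Jordan_Normal_Form.Matrix"
begin

text \<open>Matrices are those of \<^theory>\<open>Jordan_Normal_Form.Matrix\<close>, whose sizes are terms: the sizes
  \<open>n - k\<close> and \<open>r - k\<close> depend on the parameters and may be zero, which type-indexed matrices exclude.\<close>

definition frob_norm :: "real mat \<Rightarrow> real" where
  "frob_norm A = sqrt (\<Sum>i<dim_row A. \<Sum>j<dim_col A. (A $$ (i, j))\<^sup>2)"

definition hadamard :: "real mat \<Rightarrow> real mat \<Rightarrow> real mat" where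
  "hadamard A B = mat (dim_row A) (dim_col A) (\<lambda>(i, j). A $$ (i, j) * B $$ (i, j))"

text \<open>The library puts no topology on \<open>real mat\<close>; convergence is in the Frobenius norm, within
  the space of matrices of one fixed size.\<close>

definition mat_tendsto :: "(nat \<Rightarrow> real mat) \<Rightarrow> real mat \<Rightarrow> bool" where
  "mat_tendsto X L \<longleftrightarrow>
     (\<forall>p. X p \<in> carrier_mat (dim_row L) (dim_col L)) \<and>
     (\<lambda>p. frob_norm (X p - L)) \<longlonglongrightarrow> 0"

definition objective ::
  "real mat \<Rightarrow> real mat \<Rightarrow> real mat \<Rightarrow> real mat \<Rightarrow> real mat \<Rightarrow> real mat \<Rightarrow> real mat \<Rightarrow> real" where
  "objective A1 A2 W1 X1 C B D =
     (frob_norm (hadamard (A1 - X1) W1))\<^sup>2 + (frob_norm (A2 - X1 * C - B * D))\<^sup>2"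

text \<open>Each update may be any minimizer: outside the \<open>X1\<close> step the minimizer need not be unique
  (for instance, in the \<open>C\<close> step when \<open>X1\<close> is rank deficient).\<close>

definition alternating_minimization ::
  "nat \<Rightarrow> nat \<Rightarrow> nat \<Rightarrow> nat \<Rightarrow> real mat \<Rightarrow> real mat \<Rightarrow> real mat \<Rightarrow>
   (nat \<Rightarrow> real mat) \<Rightarrow> (nat \<Rightarrow> real mat) \<Rightarrow> (nat \<Rightarrow> real mat) \<Rightarrow> (nat \<Rightarrow> real mat) \<Rightarrow> bool" where
  "alternating_minimization m n k r A1 A2 W1 X1 C B D \<longleftrightarrow>
     X1 0 \<in> carrier_mat m k \<and> C 0 \<in> carrier_mat k (n - k) \<and>
     B 0 \<in> carrier_mat m (r - k) \<and> D 0 \<in> carrier_mat (r - k) (n - k) \<and>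
     (\<forall>p.
       is_arg_min (\<lambda>X. objective A1 A2 W1 X (C p) (B p) (D p))
         (\<lambda>X. X \<in> carrier_mat m k) (X1 (Suc p)) \<and>
       is_arg_min (\<lambda>Y. objective A1 A2 W1 (X1 (Suc p)) Y (B p) (D p))
         (\<lambda>Y. Y \<in> carrier_mat k (n - k)) (C (Suc p)) \<and>
       is_arg_min (\<lambda>Y. objective A1 A2 W1 (X1 (Suc p)) (C (Suc p)) Y (D p))
         (\<lambda>Y. Y \<in> carrier_mat m (r - k)) (B (Suc p)) \<and>
       is_arg_min (\<lambda>Y. objective A1 A2 W1 (X1 (Suc p)) (C (Suc p)) (B (Suc p)) Y)
         (\<lambda>Y. Y \<in> carrier_mat (r - k) (n - k)) (D (Suc p)))"

end

theory Submission
  imports Defs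
begin

text \<open>Each of the four updates solves a linear least squares problem, so by the Pythagorean identity
  it lowers the objective by exactly the squared norm of the induced change of the residual. Hence
  \<open>M p - M (p + 1)\<close> dominates \<open>\<parallel>(X\<^sub>p - X\<^sub>p\<^sub>+\<^sub>1) \<odot> W\<parallel>\<^sup>2\<close>, \<open>\<parallel>(B\<^sub>p - B\<^sub>p\<^sub>+\<^sub>1) D\<^sub>p\<parallel>\<^sup>2\<close> and
  \<open>\<parallel>B\<^sub>p\<^sub>+\<^sub>1 (D\<^sub>p - D\<^sub>p\<^sub>+\<^sub>1)\<parallel>\<^sup>2\<close>, and these decrements telescope. Summability of their square roots
  bounds the total variation of every entry.\<close>

section \<open>Identities and estimates for the Frobenius norm\<close>

lemma frob_norm_sq:
  "(frob_norm A)\<^sup>2 = (\<Sum>i<dim_row A. \<Sum>j<dim_col A. (A $$ (i, j))\<^sup>2)"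
  by (simp add: frob_norm_def sum_nonneg)

lemma frob_norm_nonneg [simp]: "0 \<le> frob_norm A"
  by (simp add: frob_norm_def sum_nonneg)

lemma frob_norm_zero_mat [simp]: "frob_norm (0\<^sub>m a b) = 0"
  by (simp add: frob_norm_def)

lemma hadamard_carrier [simp]: "A \<in> carrier_mat a b \<Longrightarrow> hadamard A W \<in> carrier_mat a b"
  by (simp add: hadamard_def)

lemma abs_index_le_frob_norm:
  assumes "i < dim_row A" "j < dim_col A"
  shows "\<bar>A $$ (i, j)\<bar> \<le> frob_norm A"
proof -
  have "(A $$ (i, j))\<^sup>2 \<le> (\<Sum>j<dim_col A. (A $$ (i, j))\<^sup>2)"
    using assms by (intro member_le_sum[where f = "\<lambda>j. (A $$ (i, j))\<^sup>2"]) auto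
  also have "\<dots> \<le> (\<Sum>i<dim_row A. \<Sum>j<dim_col A. (A $$ (i, j))\<^sup>2)"
    using assms
    by (intro member_le_sum[where f = "\<lambda>i. \<Sum>j<dim_col A. (A $$ (i, j))\<^sup>2"]) (auto intro: sum_nonneg)
  finally have "\<bar>A $$ (i, j)\<bar>\<^sup>2 \<le> (frob_norm A)\<^sup>2"
    by (simp add: frob_norm_sq)
  then show ?thesis
    by (rule power2_le_imp_le) simp
qed

lemma abs_index_diff_le_frob_norm:
  assumes "A \<in> carrier_mat a b" "B \<in> carrier_mat a b" "i < a" "j < b"
  shows "\<bar>A $$ (i, j) - B $$ (i, j)\<bar> \<le> frob_norm (A - B)"
  using abs_index_le_frob_norm[of i "A - B" j] assms by simp

text \<open>Entrywise, \<open>2 * x^2 + 2 * y^2 - (x + y)^2\<close> is the square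
  \<open>(x - y)^2\<close>; the factor 2 does no harm to summability.\<close>

lemma frob_norm_sq_add_le:
  assumes "A \<in> carrier_mat a b" "B \<in> carrier_mat a b"
  shows "(frob_norm (A + B))\<^sup>2 \<le> 2 * (frob_norm A)\<^sup>2 + 2 * (frob_norm B)\<^sup>2"
proof -
  have *: "(x + y)\<^sup>2 \<le> 2 * x\<^sup>2 + 2 * y\<^sup>2" for x y :: real
    using zero_le_power2[of "x - y"] by (simp add: power2_sum power2_diff)
  have "(\<Sum>i<a. \<Sum>j<b. (A $$ (i, j) + B $$ (i, j))\<^sup>2)
      \<le> (\<Sum>i<a. \<Sum>j<b. 2 * (A $$ (i, j))\<^sup>2 + 2 * (B $$ (i, j))\<^sup>2)"
    by (intro sum_mono *)
  then show ?thesis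
    using assms by (simp add: frob_norm_sq sum.distrib sum_distrib_left)
qed

text \<open>Along a line the squared norm is a quadratic polynomial in \<open>t\<close>. The double
  sum is the Frobenius inner product of \<open>R\<close> and \<open>H\<close>, and the leading
  coefficient depends on the direction \<open>H\<close> only.\<close>

lemma frob_norm_sq_minus_smult:
  assumes "R \<in> carrier_mat a b" "H \<in> carrier_mat a b"
  shows "(frob_norm (R - t \<cdot>\<^sub>m H))\<^sup>2 =
    (frob_norm R)\<^sup>2 - 2 * t * (\<Sum>i<a. \<Sum>j<b. R $$ (i, j) * H $$ (i, j)) + t\<^sup>2 * (frob_norm H)\<^sup>2"
proof -
  have "(frob_norm (R - t \<cdot>\<^sub>m H))\<^sup>2 =
      (\<Sum>i<a. \<Sum>j<b. (R $$ (i, j))\<^sup>2 - 2 * t * (R $$ (i, j) * H $$ (i, j)) + t\<^sup>2 * (H $$ (i, j))\<^sup>2)"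
    using assms by (simp add: frob_norm_sq power2_diff power_mult_distrib algebra_simps)
  also have "\<dots> = (frob_norm R)\<^sup>2 - 2 * t * (\<Sum>i<a. \<Sum>j<b. R $$ (i, j) * H $$ (i, j))
      + t\<^sup>2 * (frob_norm H)\<^sup>2"
    using assms by (simp add: frob_norm_sq sum.distrib sum_subtractf sum_distrib_left)
  finally show ?thesis .
qed

text \<open>Moves the varying term to the end of the residual, the shape that the quadratic
  expansion expects. The variant after it covers a varying term followed by a further
  subtraction.\<close>

lemma minus_add_smult:
  fixes R P Q :: "real mat"
  assumes "R \<in> carrier_mat a b" "P \<in> carrier_mat a b" "Q \<in> carrier_mat a b"
  shows "R - (P + t \<cdot>\<^sub>m Q) = R - P - t \<cdot>\<^sub>m Q"
  using assms by (intro eq_matI) auto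

lemma minus_add_smult_minus:
  fixes R P Q S :: "real mat"
  assumes "R \<in> carrier_mat a b" "P \<in> carrier_mat a b" "Q \<in> carrier_mat a b" "S \<in> carrier_mat a b"
  shows "R - (P + t \<cdot>\<^sub>m Q) - S = R - P - S - t \<cdot>\<^sub>m Q"
  using assms by (intro eq_matI) auto

lemma minus_add_minus_cancel:
  fixes P Q R :: "real mat"
  assumes "P \<in> carrier_mat a b" "Q \<in> carrier_mat a b" "R \<in> carrier_mat a b"
  shows "(P - R) + (R - Q) = P - Q"
  using assms by (intro eq_matI) auto

lemma frob_norm_minus_commute:
  assumes "A \<in> carrier_mat a b" "B \<in> carrier_mat a b"
  shows "frob_norm (A - B) = frob_norm (B - A)"
proof -
  have "(A $$ (i, j) - B $$ (i, j))\<^sup>2 = (B $$ (i, j) - A $$ (i, j))\<^sup>2" for i j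
    by (rule power2_commute)
  then show ?thesis
    using assms by (simp add: frob_norm_def)
qed

section \<open>Least squares along a line\<close>

lemma quadratic_min_at_zero_linear_coeff:
  fixes b q :: real
  assumes "\<And>t. 0 \<le> t\<^sup>2 * q - 2 * t * b" and "0 \<le> q"
  shows "b = 0"
proof (rule ccontr)
  assume "b \<noteq> 0"
  \<comment> \<open>The vertex of the parabola is \<open>b / q\<close>; the added 1 keeps the
    denominator positive when \<open>q = 0\<close>, and the value at \<open>u\<close> is still
    negative.\<close>
  define u where "u = b / (q + 1)"
  have b: "b = u * (q + 1)"
    using \<open>0 \<le> q\<close> by (simp add: u_def)
  have "0 \<le> u\<^sup>2 * q - 2 * u * b"
    by (rule assms)
  also have "\<dots> = - (u\<^sup>2 * (q + 2))"
    unfolding b by (simp add: algebra_simps power2_eq_square)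
  also have "\<dots> < 0"
    using \<open>0 \<le> q\<close> \<open>b \<noteq> 0\<close> b by (simp add: mult_pos_pos)
  finally show False
    by simp
qed

text \<open>A quadratic polynomial minimal at 0 has no linear term, so its growth from 0 to 1 is its
  leading coefficient. The two residuals correspond to the two summands of
  \<open>objective\<close>.\<close>

lemma least_squares_pythagoras:
  assumes R: "R1 \<in> carrier_mat a b" "R2 \<in> carrier_mat c d"
    and H: "H1 \<in> carrier_mat a b" "H2 \<in> carrier_mat c d"
    and f: "\<And>t. f t = (frob_norm (R1 - t \<cdot>\<^sub>m H1))\<^sup>2 + (frob_norm (R2 - t \<cdot>\<^sub>m H2))\<^sup>2"
    and min: "\<And>t. f 0 \<le> f t"
  shows "f 1 - f 0 = (frob_norm H1)\<^sup>2 + (frob_norm H2)\<^sup>2"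
proof -
  obtain s1 where s1: "(frob_norm (R1 - t \<cdot>\<^sub>m H1))\<^sup>2 =
      (frob_norm R1)\<^sup>2 - 2 * t * s1 + t\<^sup>2 * (frob_norm H1)\<^sup>2" for t
    using frob_norm_sq_minus_smult[OF R(1) H(1)] by blast
  obtain s2 where s2: "(frob_norm (R2 - t \<cdot>\<^sub>m H2))\<^sup>2 =
      (frob_norm R2)\<^sup>2 - 2 * t * s2 + t\<^sup>2 * (frob_norm H2)\<^sup>2" for t
    using frob_norm_sq_minus_smult[OF R(2) H(2)] by blast
  define s where "s = s1 + s2"
  define q where "q = (frob_norm H1)\<^sup>2 + (frob_norm H2)\<^sup>2"
  have f': "f t - f 0 = t\<^sup>2 * q - 2 * t * s" for t
    unfolding f s1 s2 q_def s_def by (simp add: distrib_left)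
  have "s = 0"
  proof (rule quadratic_min_at_zero_linear_coeff)
    show "0 \<le> t\<^sup>2 * q - 2 * t * s" for t
      using min[of t] f'[of t] by simp
  qed (simp add: q_def)
  then show ?thesis
    using f'[of 1] by (simp add: q_def)
qed

text \<open>The carrier is an affine space, so it contains the whole line through the minimizer and
  \<open>Y\<close>. The multiples by 0 and 1 stay visible to match \<open>f 0\<close> and
  \<open>f 1\<close> of the Pythagorean identity.\<close>

lemma is_arg_min_along_line:
  fixes f :: "real mat \<Rightarrow> real"
  assumes "is_arg_min f (\<lambda>Y. Y \<in> carrier_mat a b) Ymin" and "Y \<in> carrier_mat a b"
  shows "f (Ymin + 0 \<cdot>\<^sub>m (Y - Ymin)) \<le> f (Ymin + t \<cdot>\<^sub>m (Y - Ymin))"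
    and "f (Ymin + 0 \<cdot>\<^sub>m (Y - Ymin)) = f Ymin" and "f (Ymin + 1 \<cdot>\<^sub>m (Y - Ymin)) = f Y"
proof -
  have Ymin: "Ymin \<in> carrier_mat a b"
    using assms(1) by (simp add: is_arg_min_def)
  have 0: "Ymin + 0 \<cdot>\<^sub>m (Y - Ymin) = Ymin"
    using assms(2) Ymin by (intro eq_matI) auto
  have 1: "Ymin + 1 \<cdot>\<^sub>m (Y - Ymin) = Y"
    using assms(2) Ymin by (intro eq_matI) auto
  have "Ymin + t \<cdot>\<^sub>m (Y - Ymin) \<in> carrier_mat a b"
    using assms(2) Ymin by auto
  then show "f (Ymin + 0 \<cdot>\<^sub>m (Y - Ymin)) \<le> f (Ymin + t \<cdot>\<^sub>m (Y - Ymin))"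
    using assms(1) unfolding 0 by (simp add: is_arg_min_def not_less)
  show "f (Ymin + 0 \<cdot>\<^sub>m (Y - Ymin)) = f Ymin" "f (Ymin + 1 \<cdot>\<^sub>m (Y - Ymin)) = f Y"
    using 0 1 by simp_all
qed

section \<open>Exact decrease of the objective in each update, with \<open>l\<close> and
  \<open>s\<close> in the roles of \<open>n - k\<close> and \<open>r - k\<close>\<close>

context
  fixes m k l s :: nat and A1 A2 W1 :: "real mat"
  assumes A1: "A1 \<in> carrier_mat m k" and A2: "A2 \<in> carrier_mat m l"
begin

text \<open>Changing \<open>X\<close> moves both residuals linearly, the weighted one along
  \<open>hadamard H W1\<close> and the other along \<open>H * C\<close>, hence two squares.\<close>

lemma objective_decrease_X:
  assumes min: "is_arg_min (\<lambda>X. objective A1 A2 W1 X C B D) (\<lambda>X. X \<in> carrier_mat m k) X'"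
    and X: "X \<in> carrier_mat m k" and C: "C \<in> carrier_mat k l"
    and B: "B \<in> carrier_mat m s" and D: "D \<in> carrier_mat s l"
  shows "objective A1 A2 W1 X C B D - objective A1 A2 W1 X' C B D =
    (frob_norm (hadamard (X - X') W1))\<^sup>2 + (frob_norm ((X - X') * C))\<^sup>2"
proof -
  \<comment> \<open>\<open>H\<close> points from the minimizer to the old iterate:
    \<open>t = 0\<close> gives \<open>X'\<close> and \<open>t = 1\<close> gives
    \<open>X\<close>.\<close>
  define H where "H = X - X'"
  have X': "X' \<in> carrier_mat m k"
    using min by (simp add: is_arg_min_def)
  have H: "H \<in> carrier_mat m k"
    using X' by (simp add: H_def minus_carrier_mat)
  have HC: "H * C \<in> carrier_mat m l" and XC: "X' * C \<in> carrier_mat m l" and BD: "B * D \<in> carrier_mat m l"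
    using H X' B C D by auto
  have "hadamard (A1 - (X' + t \<cdot>\<^sub>m H)) W1 = hadamard (A1 - X') W1 - t \<cdot>\<^sub>m hadamard H W1" for t
    using A1 X' H by (intro eq_matI) (auto simp: hadamard_def algebra_simps)
  moreover have "(X' + t \<cdot>\<^sub>m H) * C = X' * C + t \<cdot>\<^sub>m (H * C)" for t
    using X' H C by (simp add: add_mult_distrib_mat[of _ m k] mult_smult_assoc_mat[of _ m k])
  moreover have "A2 - (X' * C + t \<cdot>\<^sub>m (H * C)) - B * D = (A2 - X' * C - B * D) - t \<cdot>\<^sub>m (H * C)" for t
    using A2 XC HC BD by (rule minus_add_smult_minus)
  ultimately have *: "objective A1 A2 W1 (X' + t \<cdot>\<^sub>m H) C B D =
      (frob_norm (hadamard (A1 - X') W1 - t \<cdot>\<^sub>m hadamard H W1))\<^sup>2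
      + (frob_norm ((A2 - X' * C - B * D) - t \<cdot>\<^sub>m (H * C)))\<^sup>2" for t
    by (simp add: objective_def)
  have "objective A1 A2 W1 (X' + 1 \<cdot>\<^sub>m H) C B D - objective A1 A2 W1 (X' + 0 \<cdot>\<^sub>m H) C B D =
      (frob_norm (hadamard H W1))\<^sup>2 + (frob_norm (H * C))\<^sup>2"
    by (rule least_squares_pythagoras[where f = "\<lambda>t. objective A1 A2 W1 (X' + t \<cdot>\<^sub>m H) C B D",
        OF hadamard_carrier[OF minus_carrier_mat[OF X']] minus_carrier_mat[OF BD]
          hadamard_carrier[OF H] HC * is_arg_min_along_line(1)[OF min X, folded H_def]])
  then show ?thesis
    unfolding H_def is_arg_min_along_line(2,3)[OF min X] .
qed

text \<open>Only the second residual depends on \<open>C\<close>; the first one is given the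
  direction zero, so that the two-residual identity still applies. The updates of \<open>D\<close>
  and \<open>B\<close> are treated in the same way.\<close>

lemma objective_decrease_C:
  assumes min: "is_arg_min (\<lambda>C. objective A1 A2 W1 X C B D) (\<lambda>C. C \<in> carrier_mat k l) C'"
    and X: "X \<in> carrier_mat m k" and C: "C \<in> carrier_mat k l"
    and B: "B \<in> carrier_mat m s" and D: "D \<in> carrier_mat s l"
  shows "objective A1 A2 W1 X C B D - objective A1 A2 W1 X C' B D = (frob_norm (X * (C - C')))\<^sup>2"
proof -
  define H where "H = C - C'"
  have C': "C' \<in> carrier_mat k l"
    using min by (simp add: is_arg_min_def)
  have H: "H \<in> carrier_mat k l"
    using C' by (simp add: H_def minus_carrier_mat)
  have XH: "X * H \<in> carrier_mat m l" and XC: "X * C' \<in> carrier_mat m l" and BD: "B * D \<in> carrier_mat m l"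
    using H X B C' D by auto
  have "hadamard (A1 - X) W1 - t \<cdot>\<^sub>m 0\<^sub>m m k = hadamard (A1 - X) W1" for t
    using A1 X by (intro eq_matI) (auto simp: hadamard_def)
  moreover have "X * (C' + t \<cdot>\<^sub>m H) = X * C' + t \<cdot>\<^sub>m (X * H)" for t
    using X H C' by (simp add: mult_add_distrib_mat[of _ m k _ l] mult_smult_distrib[of _ m _ _ l])
  moreover have "A2 - (X * C' + t \<cdot>\<^sub>m (X * H)) - B * D = (A2 - X * C' - B * D) - t \<cdot>\<^sub>m (X * H)" for t
    using A2 XC XH BD by (rule minus_add_smult_minus)
  ultimately have *: "objective A1 A2 W1 X (C' + t \<cdot>\<^sub>m H) B D =
      (frob_norm (hadamard (A1 - X) W1 - t \<cdot>\<^sub>m 0\<^sub>m m k))\<^sup>2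
      + (frob_norm ((A2 - X * C' - B * D) - t \<cdot>\<^sub>m (X * H)))\<^sup>2" for t
    by (simp only: objective_def)
  have "objective A1 A2 W1 X (C' + 1 \<cdot>\<^sub>m H) B D - objective A1 A2 W1 X (C' + 0 \<cdot>\<^sub>m H) B D =
      (frob_norm (0\<^sub>m m k))\<^sup>2 + (frob_norm (X * H))\<^sup>2"
    by (rule least_squares_pythagoras[where f = "\<lambda>t. objective A1 A2 W1 X (C' + t \<cdot>\<^sub>m H) B D",
        OF hadamard_carrier[OF minus_carrier_mat[OF X]] minus_carrier_mat[OF BD]
          zero_carrier_mat XH * is_arg_min_along_line(1)[OF min C, folded H_def]])
  then show ?thesis
    unfolding H_def is_arg_min_along_line(2,3)[OF min C] by simp
qed

lemma objective_decrease_D: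
  assumes min: "is_arg_min (\<lambda>D. objective A1 A2 W1 X C B D) (\<lambda>D. D \<in> carrier_mat s l) D'"
    and X: "X \<in> carrier_mat m k" and C: "C \<in> carrier_mat k l"
    and B: "B \<in> carrier_mat m s" and D: "D \<in> carrier_mat s l"
  shows "objective A1 A2 W1 X C B D - objective A1 A2 W1 X C B D' = (frob_norm (B * (D - D')))\<^sup>2"
proof -
  define H where "H = D - D'"
  have D': "D' \<in> carrier_mat s l"
    using min by (simp add: is_arg_min_def)
  have H: "H \<in> carrier_mat s l"
    using D' by (simp add: H_def minus_carrier_mat)
  have BH: "B * H \<in> carrier_mat m l" and XC: "X * C \<in> carrier_mat m l" and BD: "B * D' \<in> carrier_mat m l"
    using H X B C D' by auto
  have "hadamard (A1 - X) W1 - t \<cdot>\<^sub>m 0\<^sub>m m k = hadamard (A1 - X) W1" for t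
    using A1 X by (intro eq_matI) (auto simp: hadamard_def)
  moreover have "B * (D' + t \<cdot>\<^sub>m H) = B * D' + t \<cdot>\<^sub>m (B * H)" for t
    using B H D' by (simp add: mult_add_distrib_mat[of _ m s _ l] mult_smult_distrib[of _ m _ _ l])
  moreover have "A2 - X * C - (B * D' + t \<cdot>\<^sub>m (B * H)) = (A2 - X * C - B * D') - t \<cdot>\<^sub>m (B * H)" for t
    using minus_carrier_mat[OF XC] BD BH by (rule minus_add_smult)
  ultimately have *: "objective A1 A2 W1 X C B (D' + t \<cdot>\<^sub>m H) =
      (frob_norm (hadamard (A1 - X) W1 - t \<cdot>\<^sub>m 0\<^sub>m m k))\<^sup>2
      + (frob_norm ((A2 - X * C - B * D') - t \<cdot>\<^sub>m (B * H)))\<^sup>2" for t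
    by (simp only: objective_def)
  have "objective A1 A2 W1 X C B (D' + 1 \<cdot>\<^sub>m H) - objective A1 A2 W1 X C B (D' + 0 \<cdot>\<^sub>m H) =
      (frob_norm (0\<^sub>m m k))\<^sup>2 + (frob_norm (B * H))\<^sup>2"
    by (rule least_squares_pythagoras[where f = "\<lambda>t. objective A1 A2 W1 X C B (D' + t \<cdot>\<^sub>m H)",
        OF hadamard_carrier[OF minus_carrier_mat[OF X]] minus_carrier_mat[OF BD]
          zero_carrier_mat BH * is_arg_min_along_line(1)[OF min D, folded H_def]])
  then show ?thesis
    unfolding H_def is_arg_min_along_line(2,3)[OF min D] by simp
qed

lemma objective_decrease_B:
  assumes min: "is_arg_min (\<lambda>B. objective A1 A2 W1 X C B D) (\<lambda>B. B \<in> carrier_mat m s) B'"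
    and X: "X \<in> carrier_mat m k" and C: "C \<in> carrier_mat k l"
    and B: "B \<in> carrier_mat m s" and D: "D \<in> carrier_mat s l"
  shows "objective A1 A2 W1 X C B D - objective A1 A2 W1 X C B' D = (frob_norm ((B - B') * D))\<^sup>2"
proof -
  define H where "H = B - B'"
  have B': "B' \<in> carrier_mat m s"
    using min by (simp add: is_arg_min_def)
  have H: "H \<in> carrier_mat m s"
    using B' by (simp add: H_def minus_carrier_mat)
  have HD: "H * D \<in> carrier_mat m l" and XC: "X * C \<in> carrier_mat m l" and BD: "B' * D \<in> carrier_mat m l"
    using H X B' C D by auto
  have "hadamard (A1 - X) W1 - t \<cdot>\<^sub>m 0\<^sub>m m k = hadamard (A1 - X) W1" for t
    using A1 X by (intro eq_matI) (auto simp: hadamard_def)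
  moreover have "(B' + t \<cdot>\<^sub>m H) * D = B' * D + t \<cdot>\<^sub>m (H * D)" for t
    using B' H D by (simp add: add_mult_distrib_mat[of _ m s] mult_smult_assoc_mat[of _ m s])
  moreover have "A2 - X * C - (B' * D + t \<cdot>\<^sub>m (H * D)) = (A2 - X * C - B' * D) - t \<cdot>\<^sub>m (H * D)" for t
    using minus_carrier_mat[OF XC] BD HD by (rule minus_add_smult)
  ultimately have *: "objective A1 A2 W1 X C (B' + t \<cdot>\<^sub>m H) D =
      (frob_norm (hadamard (A1 - X) W1 - t \<cdot>\<^sub>m 0\<^sub>m m k))\<^sup>2
      + (frob_norm ((A2 - X * C - B' * D) - t \<cdot>\<^sub>m (H * D)))\<^sup>2" for t
    by (simp only: objective_def)
  have "objective A1 A2 W1 X C (B' + 1 \<cdot>\<^sub>m H) D - objective A1 A2 W1 X C (B' + 0 \<cdot>\<^sub>m H) D =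
      (frob_norm (0\<^sub>m m k))\<^sup>2 + (frob_norm (H * D))\<^sup>2"
    by (rule least_squares_pythagoras[where f = "\<lambda>t. objective A1 A2 W1 X C (B' + t \<cdot>\<^sub>m H) D",
        OF hadamard_carrier[OF minus_carrier_mat[OF X]] minus_carrier_mat[OF BD]
          zero_carrier_mat HD * is_arg_min_along_line(1)[OF min B, folded H_def]])
  then show ?thesis
    unfolding H_def is_arg_min_along_line(2,3)[OF min B] by simp
qed

end

section \<open>Entrywise convergence of matrix sequences\<close>

text \<open>Each entry is bounded by the norm, and the norm is a continuous function of finitely
  many entries.\<close>

lemma mat_tendsto_iff_index:
  assumes X: "\<And>p. X p \<in> carrier_mat a b" and L: "L \<in> carrier_mat a b"
  shows "mat_tendsto X L \<longleftrightarrow> (\<forall>i<a. \<forall>j<b. (\<lambda>p. X p $$ (i, j)) \<longlonglongrightarrow> L $$ (i, j))"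
proof
  assume lim: "mat_tendsto X L"
  show "\<forall>i<a. \<forall>j<b. (\<lambda>p. X p $$ (i, j)) \<longlonglongrightarrow> L $$ (i, j)"
  proof (intro allI impI)
    fix i j assume ij: "i < a" "j < b"
    have "\<bar>X p $$ (i, j) - L $$ (i, j)\<bar> \<le> frob_norm (X p - L)" for p
      using X L ij by (rule abs_index_diff_le_frob_norm)
    then have "(\<lambda>p. X p $$ (i, j) - L $$ (i, j)) \<longlonglongrightarrow> 0"
      using lim by (auto simp: mat_tendsto_def intro: tendsto_0_le[where K = 1])
    then show "(\<lambda>p. X p $$ (i, j)) \<longlonglongrightarrow> L $$ (i, j)"
      by (simp add: LIM_zero_iff)
  qed
next
  assume lim: "\<forall>i<a. \<forall>j<b. (\<lambda>p. X p $$ (i, j)) \<longlonglongrightarrow> L $$ (i, j)"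
  have "(\<lambda>p. sqrt (\<Sum>i<a. \<Sum>j<b. (X p $$ (i, j) - L $$ (i, j))\<^sup>2)) \<longlonglongrightarrow>
      sqrt (\<Sum>i<a. \<Sum>j<b. (L $$ (i, j) - L $$ (i, j))\<^sup>2)"
    by (intro tendsto_real_sqrt tendsto_sum tendsto_power tendsto_diff tendsto_const) (use lim in auto)
  moreover have "frob_norm (X p - L) = sqrt (\<Sum>i<a. \<Sum>j<b. (X p $$ (i, j) - L $$ (i, j))\<^sup>2)" for p
    using X[of p] L by (simp add: frob_norm_def)
  ultimately show "mat_tendsto X L"
    using X L by (auto simp: mat_tendsto_def)
qed

text \<open>The increments are summable by comparison, and their partial sums telescope to
  \<open>x n - x 0\<close>.\<close>

lemma convergent_if_summable_increments:
  fixes x :: "nat \<Rightarrow> real"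
  assumes "summable e" and "\<And>p. \<bar>x (Suc p) - x p\<bar> \<le> c * e p"
  shows "convergent x"
proof -
  have "summable (\<lambda>p. x (Suc p) - x p)"
    using assms(2) by (intro summable_comparison_test[OF _ summable_mult[OF assms(1)]]) auto
  then have "convergent (\<lambda>n. x n - x 0)"
    by (simp add: summable_iff_convergent sum_lessThan_telescope)
  then show ?thesis
    using convergent_diff_const_right_iff by blast
qed

text \<open>The entrywise limits are assembled into one matrix. The constant \<open>c i j\<close>
  may vary with the entry, which admits the reciprocals of the weights.\<close>

lemma mat_tendsto_exists:
  assumes X: "\<And>p. X p \<in> carrier_mat a b" and "summable e"
    and "\<And>i j p. i < a \<Longrightarrow> j < b \<Longrightarrow> \<bar>X (Suc p) $$ (i, j) - X p $$ (i, j)\<bar> \<le> c i j * e p"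
  shows "\<exists>L. mat_tendsto X L"
proof -
  define L where "L = mat a b (\<lambda>(i, j). lim (\<lambda>p. X p $$ (i, j)))"
  have "convergent (\<lambda>p. X p $$ (i, j))" if "i < a" "j < b" for i j
    using assms that by (intro convergent_if_summable_increments[of e _ "c i j"]) auto
  then have "mat_tendsto X L"
    by (subst mat_tendsto_iff_index[OF X]) (auto simp: L_def convergent_LIMSEQ_iff)
  then show ?thesis ..
qed

section \<open>Summability and convergence for the alternating scheme\<close>

theorem theorem4p4:
  fixes m n k r :: nat
    and A1 A2 W1 :: "real mat"
    and X1 C B D :: "nat \<Rightarrow> real mat"
    and M :: "nat \<Rightarrow> real"
  assumes "k \<le> r" and "r \<le> min m n"
    and "A1 \<in> carrier_mat m k" and "A2 \<in> carrier_mat m (n - k)"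
    and "W1 \<in> carrier_mat m k"
    and "\<And>i j. i < m \<Longrightarrow> j < k \<Longrightarrow> W1 $$ (i, j) > 0"
    and "alternating_minimization m n k r A1 A2 W1 X1 C B D"
    and "\<And>p. M p = objective A1 A2 W1 (X1 p) (C p) (B p) (D p)"
  shows "(summable (\<lambda>p. (frob_norm (B (p + 2) * D (p + 2) - B (p + 1) * D (p + 1)))\<^sup>2) \<and>
          summable (\<lambda>p. (frob_norm (hadamard (X1 (p + 1) - X1 (p + 2)) W1))\<^sup>2)) \<and>
         (summable (\<lambda>p. sqrt (M (p + 1) - M (p + 2))) \<longrightarrow>
           (\<exists>L. mat_tendsto (\<lambda>p. B p * D p) L) \<and>
           (\<exists>X. mat_tendsto X1 X) \<and>
           (\<forall>L. mat_tendsto (\<lambda>p. B p * D p) L \<longrightarrow> mat_tendsto (\<lambda>p. B (p + 1) * D p) L))"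
proof -
  note am = assms(7)[unfolded alternating_minimization_def]
  have minX: "is_arg_min (\<lambda>X. objective A1 A2 W1 X (C p) (B p) (D p))
         (\<lambda>X. X \<in> carrier_mat m k) (X1 (Suc p))"
    and minC: "is_arg_min (\<lambda>Y. objective A1 A2 W1 (X1 (Suc p)) Y (B p) (D p))
         (\<lambda>Y. Y \<in> carrier_mat k (n - k)) (C (Suc p))"
    and minB: "is_arg_min (\<lambda>Y. objective A1 A2 W1 (X1 (Suc p)) (C (Suc p)) Y (D p))
         (\<lambda>Y. Y \<in> carrier_mat m (r - k)) (B (Suc p))"
    and minD: "is_arg_min (\<lambda>Y. objective A1 A2 W1 (X1 (Suc p)) (C (Suc p)) (B (Suc p)) Y)
         (\<lambda>Y. Y \<in> carrier_mat (r - k) (n - k)) (D (Suc p))" for p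
    using am by blast+
  have X: "X1 p \<in> carrier_mat m k" for p
    using am minX by (cases p) (auto simp: is_arg_min_def)
  have C: "C p \<in> carrier_mat k (n - k)" for p
    using am minC by (cases p) (auto simp: is_arg_min_def)
  have B: "B p \<in> carrier_mat m (r - k)" for p
    using am minB by (cases p) (auto simp: is_arg_min_def)
  have D: "D p \<in> carrier_mat (r - k) (n - k)" for p
    using am minD by (cases p) (auto simp: is_arg_min_def)
  \<comment> \<open>Independent indices, because the mixed products \<open>B (Suc p) * D p\<close>
    occur as well.\<close>
  have BD: "B p * D q \<in> carrier_mat m (n - k)" for p q
    using mult_carrier_mat[OF B D] .

  \<comment> \<open>The change of \<open>B p * D p\<close> is split at
    \<open>B (Suc p) * D p\<close>: \<open>U p\<close> comes from the update of \<open>B\<close>,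
    \<open>V p\<close> from the update of \<open>D\<close>.\<close>
  define U where "U p = (B p - B (Suc p)) * D p" for p
  define V where "V p = B (Suc p) * (D p - D (Suc p))" for p
  define Z where "Z p = hadamard (X1 p - X1 (Suc p)) W1" for p
  have U: "U p \<in> carrier_mat m (n - k)" and V: "V p \<in> carrier_mat m (n - k)" for p
    using B D unfolding U_def V_def by (meson minus_carrier_mat mult_carrier_mat)+
  have Z: "Z p \<in> carrier_mat m k" for p
    using X by (simp add: Z_def minus_carrier_mat)
  \<comment> \<open>Adding the four exact decreases cancels the intermediate objective values. The
    squares of \<open>(X1 p - X1 (Suc p)) * C p\<close> and
    \<open>X1 (Suc p) * (C p - C (Suc p))\<close> are dropped, hence an inequality.\<close>
  have decrease: "(frob_norm (Z p))\<^sup>2 + (frob_norm (U p))\<^sup>2 + (frob_norm (V p))\<^sup>2 \<le> M p - M (Suc p)" for p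
    using objective_decrease_X[OF assms(3,4) minX X C B D, of p p]
      objective_decrease_C[OF assms(3,4) minC X C B D, of p p]
      objective_decrease_B[OF assms(3,4) minB X C B D, of p p]
      objective_decrease_D[OF assms(3,4) minD X C B D, of p p]
      zero_le_power2[of "frob_norm ((X1 p - X1 (Suc p)) * C p)"]
      zero_le_power2[of "frob_norm (X1 (Suc p) * (C p - C (Suc p)))"]
    unfolding assms(8) U_def V_def Z_def by linarith
  have mono: "M (Suc p) \<le> M p"
    and Z_sq_le: "(frob_norm (Z p))\<^sup>2 \<le> M p - M (Suc p)"
    and U_sq_le: "(frob_norm (U p))\<^sup>2 \<le> M p - M (Suc p)"
    and UV_sq_le: "2 * (frob_norm (U p))\<^sup>2 + 2 * (frob_norm (V p))\<^sup>2 \<le> 2 * (M p - M (Suc p))" for p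
    using decrease[of p] by (smt (verit) zero_le_power2)+
  have U_eq: "U p = B p * D p - B (Suc p) * D p" for p
    using minus_mult_distrib_mat[OF B B D] by (simp add: U_def)
  have V_eq: "V p = B (Suc p) * D p - B (Suc p) * D (Suc p)" for p
    using mult_minus_distrib_mat[OF B D D] by (simp add: V_def)

  have BD_le: "(frob_norm (B (Suc p) * D (Suc p) - B p * D p))\<^sup>2 \<le> 2 * (M p - M (Suc p))" for p
  proof -
    \<comment> \<open>The sum \<open>U p + V p\<close> telescopes to the old product minus the new
      one, so the sign has to be flipped.\<close>
    have *: "frob_norm (B (Suc p) * D (Suc p) - B p * D p) = frob_norm (U p + V p)"
      unfolding U_eq V_eq minus_add_minus_cancel[OF BD BD BD] by (rule frob_norm_minus_commute[OF BD BD])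
    show ?thesis
      unfolding * using frob_norm_sq_add_le[OF U V] UV_sq_le by (rule order_trans)
  qed

  have "0 \<le> M p" for p
    by (simp add: assms(8) objective_def)
  \<comment> \<open>\<open>M\<close> is decreasing and bounded below by 0, so its decrements form a
    convergent telescoping series.\<close>
  then have "convergent M"
    using mono by (intro Bseq_monoseq_convergent decseq_imp_monoseq decseq_SucI decseq_bounded[of _ 0]) auto
  then have "summable (\<lambda>p. M p - M (Suc p))"
    using telescope_summable'[of M] by (auto simp: convergent_def)
  then have summable_M: "summable (\<lambda>p. M (Suc p) - M (Suc (Suc p)))"
    by (subst summable_Suc_iff)

  have "summable (\<lambda>p. (frob_norm (B (p + 2) * D (p + 2) - B (p + 1) * D (p + 1)))\<^sup>2)"
  proof (intro summable_comparison_test[OF _ summable_mult[OF summable_M, of 2]] exI allI impI)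
    fix p
    show "norm ((frob_norm (B (p + 2) * D (p + 2) - B (p + 1) * D (p + 1)))\<^sup>2)
        \<le> 2 * (M (Suc p) - M (Suc (Suc p)))"
      using BD_le[of "Suc p"] by simp
  qed
  moreover have "summable (\<lambda>p. (frob_norm (hadamard (X1 (p + 1) - X1 (p + 2)) W1))\<^sup>2)"
  proof (intro summable_comparison_test[OF _ summable_M] exI allI impI)
    fix p
    show "norm ((frob_norm (hadamard (X1 (p + 1) - X1 (p + 2)) W1))\<^sup>2) \<le> M (Suc p) - M (Suc (Suc p))"
      using Z_sq_le[of "Suc p"] by (simp add: Z_def)
  qed
  moreover have "(\<exists>L. mat_tendsto (\<lambda>p. B p * D p) L) \<and> (\<exists>X. mat_tendsto X1 X) \<and>
      (\<forall>L. mat_tendsto (\<lambda>p. B p * D p) L \<longrightarrow> mat_tendsto (\<lambda>p. B (p + 1) * D p) L)"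
    if "summable (\<lambda>p. sqrt (M (p + 1) - M (p + 2)))"
  proof -
    define e where "e p = sqrt (M p - M (Suc p))" for p
    have e: "summable e"
      \<comment> \<open>The hypothesis starts at index 1 while \<open>e\<close> starts at 0; one
        extra term does not affect summability.\<close>
      using that by (subst summable_Suc_iff[symmetric]) (simp add: e_def)
    have Z_le: "frob_norm (Z p) \<le> e p" and U_le: "frob_norm (U p) \<le> e p" for p
      using Z_sq_le U_sq_le unfolding e_def by (auto intro: real_le_rsqrt)
    have BD_le': "frob_norm (B (Suc p) * D (Suc p) - B p * D p) \<le> sqrt 2 * e p" for p
      using BD_le[of p] unfolding e_def real_sqrt_mult[symmetric] by (rule real_le_rsqrt)

    have "\<exists>L. mat_tendsto (\<lambda>p. B p * D p) L"
    proof (rule mat_tendsto_exists[OF BD e])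
      fix i j p assume ij: "i < m" "j < n - k"
      show "\<bar>(B (Suc p) * D (Suc p)) $$ (i, j) - (B p * D p) $$ (i, j)\<bar> \<le> sqrt 2 * e p"
        using abs_index_diff_le_frob_norm[OF BD BD ij] BD_le' by (rule order_trans)
    qed
    moreover have "\<exists>X. mat_tendsto X1 X"
    proof (rule mat_tendsto_exists[OF X e])
      fix i j p assume ij: "i < m" "j < k"
      \<comment> \<open>The positive weight can be taken out of the absolute value and later divided
        away, which yields the constant \<open>1 / W1 $$ (i, j)\<close>.\<close>
      have "W1 $$ (i, j) * \<bar>X1 (Suc p) $$ (i, j) - X1 p $$ (i, j)\<bar> = \<bar>Z p $$ (i, j)\<bar>"
        using assms(6)[OF ij] ij X[of p] X[of "Suc p"]
        by (simp add: Z_def hadamard_def abs_mult abs_minus_commute mult.commute)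
      also have "\<dots> \<le> e p"
        using abs_index_le_frob_norm[of i "Z p" j] ij Z[of p] Z_le[of p] by simp
      finally show "\<bar>X1 (Suc p) $$ (i, j) - X1 p $$ (i, j)\<bar> \<le> (1 / W1 $$ (i, j)) * e p"
        using assms(6)[OF ij] by (simp add: field_simps)
    qed
    moreover have "mat_tendsto (\<lambda>p. B (p + 1) * D p) L" if lim: "mat_tendsto (\<lambda>p. B p * D p) L" for L
    proof -
      \<comment> \<open>\<open>mat_tendsto\<close> forces the limit to have the size of the
        terms.\<close>
      have L: "L \<in> carrier_mat m (n - k)"
        using lim BD[of 0 0] unfolding mat_tendsto_def by (metis carrier_matD carrier_mat_triv)
      have "(\<lambda>p. (B (p + 1) * D p) $$ (i, j)) \<longlonglongrightarrow> L $$ (i, j)" if ij: "i < m" "j < n - k" for i j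
      proof -
        \<comment> \<open>The mixed product differs from \<open>B p * D p\<close> by
          \<open>U p\<close>, whose norm is at most the term \<open>e p\<close> of a summable series
          and so tends to 0; hence both have the same limit.\<close>
        have "\<bar>(B p * D p) $$ (i, j) - (B (Suc p) * D p) $$ (i, j)\<bar> \<le> e p" for p
          using abs_index_diff_le_frob_norm[OF BD BD ij] U_le[unfolded U_eq] by (rule order_trans)
        then have "(\<lambda>p. (B p * D p) $$ (i, j) - (B (Suc p) * D p) $$ (i, j)) \<longlonglongrightarrow> 0"
          by (intro tendsto_0_le[OF summable_LIMSEQ_zero[OF e], where K = 1] always_eventually)
            (auto intro: order_trans[OF _ abs_ge_self])
        moreover have "(\<lambda>p. (B p * D p) $$ (i, j)) \<longlonglongrightarrow> L $$ (i, j)"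
          using lim ij mat_tendsto_iff_index[of "\<lambda>p. B p * D p", OF BD L] by blast
        ultimately have "(\<lambda>p. (B p * D p) $$ (i, j) -
            ((B p * D p) $$ (i, j) - (B (Suc p) * D p) $$ (i, j))) \<longlonglongrightarrow> L $$ (i, j) - 0"
          by (intro tendsto_diff)
        then show ?thesis
          by (simp del: index_mult_mat(1))
      qed
      then show ?thesis
        by (subst mat_tendsto_iff_index[OF BD L]) blast
    qed
    ultimately show ?thesis
      by blast
  qed
  ultimately show ?thesis
    by blast
qed

end
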